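(* For any $K\ge 1$ and any predefined stepsize coefficients $\{M_k\}_{k=0}^{K-1}$ (possibly depending on the problem parameters $L,\sigma^2$ and $K$), there exists an instance of the composite problem $\min_{x\in\mathbb{R}^d}\{F(x):=f(x)+\psi(x)\}$ with $f(x):=\frac L2\|x\|^2$ and $\psi(x):=\frac a2\|x\|^2$, $a:=\max_{0\le k\le K-1}M_k$, such that (i) $F$ is bounded below, i.e. there is $F^\star\in\mathbb{R}$ with $F^\star\le F(x)$ for all $x\in\mathbb{R}^d$; (ii) $f$ has $L$-Lipschitz gradient, i.e. $\|\nabla f(x)-\nabla f(y)\|\le L\|x-y\|$ for all $x,y\in\mathbb{R}^d$; and there is the stochastic gradient oracle $\nabla f(x,\xi):=\nabla f(x)+\xi$, $\xi\sim\mathcal{N}(0,\sigma^2 I)$, satisfying (iii) $\mathbb{E}[\nabla f(x,\xi)]=\nabla f(x)$ and $\mathbb{E}\bigl[\|\nabla f(x,\xi)-\nabla f(x)\|^2\bigr]\le\sigma^2$ for all $x\in\mathbb{R}^d$; such that, for the sequence $\{x_k\}_{k=1}^K$ generated by the stochastic proximal gradient method $$x_{k+1}=\operatorname*{arg\,min}_{x\in\mathbb{R}^d}\Bigl\{\langle g_k,x\rangle+\psi(x)+\frac{M_k}{2}\|x-x_k\|^2\Bigr\},\qquad g_k=\nabla f(x_k,\xi_k),\quad 0\le k\le K-1,$$ started from any initial point $x_0$, it holds that $\mathbb{E}\bigl[\|\nabla F(x_k)\|^2\bigr]\ge\frac14\sigma^2$ for any $1\le k\le K$.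
   Context: The problem is posed in the ambient space $\mathbb{R}^d$; $\|\cdot\|$ is the Euclidean norm and $I$ the $d\times d$ identity matrix. $L>0$ and $\sigma^2\ge 0$ are the problem parameters (smoothness constant of $f$ and variance bound of the gradient oracle). The stepsize coefficients satisfy $M_k>0$. At each iteration $k$ the oracle is called with a fresh noise sample $\xi_k$, an independent copy of $\xi$.
   Formalization: For d ≥ 2 and σ > 0, noise N(0,σ²I) has E‖ξ‖² = dσ² > σ², so the variance bound in (iii) fails; it is claimed only for covariance (σ²/d)I (equal to σ²I when d = 1 or σ = 0), and all other claims are proved for both covariances. *)

theory Defs
  imports "HOL-Probability.Probability"
begin

text \<open>The law \<open>N(0, v I)\<close> on \<open>\<real>\<^sup>d\<close>, as the law of \<open>sqrt v \<cdot> Z\<close> where the coordinates of \<open>Z\<close> are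
  independent standard normal. Unlike a definition by density, this includes the degenerate case
  \<open>v = 0\<close> (Dirac measure at the origin). The second moment of the norm is \<open>d v\<close>, so it is bounded
  by \<open>\<sigma>\<^sup>2\<close> for \<open>v = \<sigma>\<^sup>2\<close> only if \<open>d = 1\<close> or \<open>\<sigma> = 0\<close>; \<open>v = \<sigma>\<^sup>2 / d\<close> makes it equal to \<open>\<sigma>\<^sup>2\<close>
  in every dimension.\<close>

definition isotropic_gaussian :: "real \<Rightarrow> (real ^ 'd::finite) measure" where
  "isotropic_gaussian v =
     distr (Pi\<^sub>M UNIV (\<lambda>_. density lborel std_normal_density)) borel
       (\<lambda>z. \<chi> i. sqrt v * z i)"

text \<open>Stochastic proximal gradient method along one realisation \<open>z 0, z 1, \<dots>\<close> of the noise;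
  \<open>G x z\<close> is the value of the gradient oracle at \<open>x\<close> with noise \<open>z\<close>.\<close>

primrec sprox_grad ::
  "('a \<Rightarrow> 'b \<Rightarrow> 'a) \<Rightarrow> ('a \<Rightarrow> real) \<Rightarrow> (nat \<Rightarrow> real) \<Rightarrow> 'a \<Rightarrow> (nat \<Rightarrow> 'b) \<Rightarrow> nat \<Rightarrow> 'a::real_inner" where
  "sprox_grad G \<psi> M x\<^sub>0 z 0 = x\<^sub>0"
| "sprox_grad G \<psi> M x\<^sub>0 z (Suc k) =
     (let x\<^sub>k = sprox_grad G \<psi> M x\<^sub>0 z k; g\<^sub>k = G x\<^sub>k (z k)
      in arg_min (\<lambda>x. inner g\<^sub>k x + \<psi> x + M k / 2 * (norm (x - x\<^sub>k))\<^sup>2) (\<lambda>_. True))"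

end

theory Submission
  imports Defs
begin

text \<open>
  Both components are quadratic, so each proximal step has a closed form: the objective is
  \<open>(a + M\<^sub>k) / 2 \<cdot> \<parallel>x - y\<parallel>\<^sup>2\<close> plus a constant, where
  \<open>y = ((M\<^sub>k - L) x\<^sub>k - \<xi>\<^sub>k) / (a + M\<^sub>k)\<close>, hence \<open>x\<^sub>k\<^sub>+\<^sub>1 = y\<close> (\<open>prox_quadratic\<close>). The iterates
  therefore follow a linear recursion driven by the noise, and \<open>x\<^sub>k\<close> is an affine function of
  \<open>\<xi>\<^sub>0, \<dots>, \<xi>\<^sub>k\<^sub>-\<^sub>1\<close>. Independent centred noise is uncorrelated with it, so the cross term in the
  second moment vanishes and the last noise sample survives in full:
  \[ E \parallel x_{k+1} \parallel^2 \ge \frac{E \parallel \xi_k \parallel^2}{(a + M_k)^2}. \]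
  This is \<open>linear_recursion_second_moment\<close>. Since \<open>\<nabla>F(x) = (L + a) x\<close> and \<open>M\<^sub>k \<le> a\<close>, the factor
  \<open>(L + a)\<^sup>2 / (a + M\<^sub>k)\<^sup>2\<close> is at least \<open>1/4\<close>: a curvature \<open>a\<close> of the regulariser as large as every
  step size coefficient keeps the gradient noise from being damped. Finally
  \<open>E \<parallel>\<xi>\<^sub>k\<parallel>\<^sup>2 = d v\<close> is at least \<open>\<sigma>\<^sup>2\<close> for both scalings of the variance, \<open>v = \<sigma>\<^sup>2\<close> and
  \<open>v = \<sigma>\<^sup>2 / d\<close>.
\<close>

section \<open>Moments of the isotropic Gaussian\<close>

abbreviation std_normal_product :: "('d::finite \<Rightarrow> real) measure" where
  "std_normal_product \<equiv> Pi\<^sub>M UNIV (\<lambda>_. density lborel std_normal_density)"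

lemma has_bochner_integral_distr_iff:
  fixes f :: "'b \<Rightarrow> 'c::{banach, second_countable_topology}"
  assumes "f \<in> borel_measurable N" "g \<in> measurable M N"
  shows "has_bochner_integral (distr M N g) f c \<longleftrightarrow> has_bochner_integral M (\<lambda>x. f (g x)) c"
  using assms by (simp add: has_bochner_integral_iff integrable_distr_eq integral_distr)

lemma measurable_vec_scaled:
  "(\<lambda>z. \<chi> i. s * z i) \<in> borel_measurable (std_normal_product :: ('d::finite \<Rightarrow> real) measure)"
proof (subst borel_measurable_euclidean_space, safe)
  fix b :: "real ^ 'd" assume "b \<in> Basis"
  then obtain i where "b = axis i 1"
    by (auto simp: Basis_vec_def)
  then show "(\<lambda>z. (\<chi> i. s * z i) \<bullet> b) \<in> borel_measurable std_normal_product"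
    by (simp add: inner_axis)
qed

lemma prob_space_std_normal: "prob_space (density lborel std_normal_density)"
  by (rule prob_space_normal_density) simp

lemma prob_space_isotropic_gaussian:
  "prob_space (isotropic_gaussian v :: (real ^ 'd::finite) measure)"
  unfolding isotropic_gaussian_def
  by (intro prob_space.prob_space_distr prob_space_PiM prob_space_std_normal measurable_vec_scaled)

lemma sets_isotropic_gaussian [measurable_cong]: "sets (isotropic_gaussian v) = sets borel"
  by (simp add: isotropic_gaussian_def)

text \<open>Each marginal is the law of \<open>sqrt v \<cdot> Z\<close> with \<open>Z\<close> standard normal, so integrals of functions
  of one coordinate are one-dimensional.\<close>

lemma has_bochner_integral_isotropic_gaussian_nth:
  fixes h :: "real \<Rightarrow> real" and i :: "'d::finite"
  assumes [measurable]: "h \<in> borel_measurable borel"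
    and h: "has_bochner_integral lborel (\<lambda>t. std_normal_density t * h (sqrt v * t)) c"
  shows "has_bochner_integral (isotropic_gaussian v) (\<lambda>z :: real ^ 'd. h (z $ i)) c"
proof -
  let ?N = "density lborel std_normal_density"
  have "has_bochner_integral ?N (\<lambda>t. h (sqrt v * t)) c"
    using h by (intro has_bochner_integral_density) auto
  moreover have marginal: "distr std_normal_product ?N (\<lambda>z :: 'd \<Rightarrow> real. z i) = ?N"
    by (rule distr_PiM_component) (simp_all add: prob_space_std_normal)
  ultimately have "has_bochner_integral (distr std_normal_product ?N (\<lambda>z :: 'd \<Rightarrow> real. z i))
      (\<lambda>t. h (sqrt v * t)) c"
    by (simp only: marginal)
  then have "has_bochner_integral (std_normal_product :: ('d \<Rightarrow> real) measure)
      (\<lambda>z. h (sqrt v * z i)) c"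
    by (subst (asm) has_bochner_integral_distr_iff) auto
  then show ?thesis
    unfolding isotropic_gaussian_def
    by (subst has_bochner_integral_distr_iff) (auto intro: measurable_vec_scaled)
qed

lemma isotropic_gaussian_nth_mean:
  "has_bochner_integral (isotropic_gaussian v) (\<lambda>z :: real ^ 'd::finite. z $ i) 0"
proof -
  have "has_bochner_integral lborel (\<lambda>t. std_normal_density t * (sqrt v * t)) 0"
    using has_bochner_integral_mult_right[OF std_normal_moment_odd[of 0], of "sqrt v"]
    by (simp add: ac_simps)
  then show ?thesis
    by (intro has_bochner_integral_isotropic_gaussian_nth[where h = "\<lambda>t. t"]) auto
qed

lemma isotropic_gaussian_nth_second_moment:
  assumes "v \<ge> 0"
  shows "has_bochner_integral (isotropic_gaussian v) (\<lambda>z :: real ^ 'd::finite. (z $ i)\<^sup>2) v"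
proof -
  have "has_bochner_integral lborel (\<lambda>t. v * (std_normal_density t * t\<^sup>2)) v"
    using has_bochner_integral_mult_right[OF std_normal_moment_even[of 1], of v] by simp
  then have "has_bochner_integral lborel (\<lambda>t. std_normal_density t * (sqrt v * t)\<^sup>2) v"
    using assms by (simp add: power_mult_distrib ac_simps)
  then show ?thesis
    by (intro has_bochner_integral_isotropic_gaussian_nth[where h = "\<lambda>t. t\<^sup>2"]) auto
qed

lemma isotropic_gaussian_second_moment:
  assumes "v \<ge> 0"
  shows "has_bochner_integral (isotropic_gaussian v) (\<lambda>z :: real ^ 'd::finite. (norm z)\<^sup>2)
    (real CARD('d) * v)"
proof -
  have "has_bochner_integral (isotropic_gaussian v) (\<lambda>z :: real ^ 'd. \<Sum>i\<in>UNIV. (z $ i)\<^sup>2)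
      (\<Sum>i\<in>(UNIV :: 'd set). v)"
    by (intro has_bochner_integral_sum isotropic_gaussian_nth_second_moment assms)
  moreover have "(\<Sum>i\<in>UNIV. (z $ i)\<^sup>2) = (norm z)\<^sup>2" for z :: "real ^ 'd"
    unfolding power2_norm_eq_inner inner_vec_def by (simp add: power2_eq_square)
  ultimately show ?thesis
    by simp
qed

section \<open>Square-integrable vectors\<close>

lemma integrable_inner_of_square_integrable:
  fixes X Y :: "'w \<Rightarrow> 'a::euclidean_space"
  assumes [measurable]: "X \<in> borel_measurable P" "Y \<in> borel_measurable P"
    and "integrable P (\<lambda>\<omega>. (norm (X \<omega>))\<^sup>2)" "integrable P (\<lambda>\<omega>. (norm (Y \<omega>))\<^sup>2)"
  shows "integrable P (\<lambda>\<omega>. X \<omega> \<bullet> Y \<omega>)"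
proof (rule Bochner_Integration.integrable_bound)
  show "integrable P (\<lambda>\<omega>. (norm (X \<omega>))\<^sup>2 + (norm (Y \<omega>))\<^sup>2)"
    using assms by simp
  have "\<bar>x \<bullet> y\<bar> \<le> (norm x)\<^sup>2 + (norm y)\<^sup>2" for x y :: 'a
  proof -
    have "\<bar>x \<bullet> y\<bar> \<le> norm x * norm y"
      by (rule Cauchy_Schwarz_ineq2)
    moreover have "0 \<le> norm x * norm y"
      by simp
    ultimately show ?thesis
      using sum_squares_bound[of "norm x" "norm y"] by linarith
  qed
  then show "AE \<omega> in P. norm (X \<omega> \<bullet> Y \<omega>) \<le> norm ((norm (X \<omega>))\<^sup>2 + (norm (Y \<omega>))\<^sup>2)"
    by (intro AE_I2) (simp add: order_trans[OF _ abs_ge_self])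
qed measurable

lemma (in prob_space) integrable_of_square_integrable_norm:
  fixes X :: "'a \<Rightarrow> 'b::euclidean_space"
  assumes [measurable]: "X \<in> borel_measurable M"
    and "integrable M (\<lambda>\<omega>. (norm (X \<omega>))\<^sup>2)"
  shows "integrable M X"
proof (rule Bochner_Integration.integrable_bound)
  show "integrable M (\<lambda>\<omega>. 1 + (norm (X \<omega>))\<^sup>2)"
    using assms by simp
  \<comment> \<open>\<open>2 \<parallel>x\<parallel> \<le> 1 + \<parallel>x\<parallel>\<^sup>2\<close>, and constants are integrable on a probability space.\<close>
  have "norm x \<le> 1 + (norm x)\<^sup>2" for x :: 'b
    using sum_squares_bound[of 1 "norm x"] norm_ge_zero[of x]
    by (simp only: power_one mult_1_right)
  then show "AE \<omega> in M. norm (X \<omega>) \<le> norm (1 + (norm (X \<omega>))\<^sup>2)"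
    by (intro AE_I2) (simp add: order_trans[OF _ abs_ge_self])
qed measurable

lemma (in prob_space) indep_vars_centred_uncorrelated:
  fixes X :: "'i \<Rightarrow> 'a \<Rightarrow> 'b::euclidean_space"
  assumes indep: "indep_vars (\<lambda>_. borel) X I"
    and ij: "i \<in> I" "j \<in> I" "i \<noteq> j"
    and int: "integrable M (X i)" "integrable M (X j)"
    and mean: "expectation (X i) = 0"
  shows "expectation (\<lambda>\<omega>. X i \<omega> \<bullet> X j \<omega>) = 0"
proof -
  have *: "integrable M (\<lambda>\<omega>. (X i \<omega> \<bullet> b) * (X j \<omega> \<bullet> b)) \<and>
      expectation (\<lambda>\<omega>. (X i \<omega> \<bullet> b) * (X j \<omega> \<bullet> b)) = 0" for b
  proof -
    have ind: "indep_vars (\<lambda>_. borel) (\<lambda>l \<omega>. X l \<omega> \<bullet> b) {i, j}"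
      using ij by (intro indep_vars_compose2[OF indep_vars_subset[OF indep]]) auto
    have int_b: "integrable M (\<lambda>\<omega>. X l \<omega> \<bullet> b)" if "l \<in> {i, j}" for l
      using that int by auto
    have "expectation (\<lambda>\<omega>. X i \<omega> \<bullet> b) = 0"
      using integral_inner_left[OF int(1), of b] mean by simp
    then show ?thesis
      using indep_vars_lebesgue_integral[OF _ ind int_b] indep_vars_integrable[OF _ ind int_b] ij
      by simp
  qed
  have "expectation (\<lambda>\<omega>. X i \<omega> \<bullet> X j \<omega>)
      = expectation (\<lambda>\<omega>. \<Sum>b\<in>Basis. (X i \<omega> \<bullet> b) * (X j \<omega> \<bullet> b))"
    by (subst euclidean_inner) simp
  also have "\<dots> = 0"
    using * by (subst Bochner_Integration.integral_sum) auto
  finally show ?thesis .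
qed

section \<open>Linear recursions driven by uncorrelated noise\<close>

text \<open>The induction carries two facts: the state is square-integrable, and it is uncorrelated with
  all noise samples that have not been used yet. Correlations propagate linearly through the
  recursion: a future sample is uncorrelated with the state by the invariant and with the current
  sample by assumption, hence with the next state.\<close>

lemma (in prob_space) linear_recursion_uncorrelated:
  fixes X \<xi> :: "nat \<Rightarrow> 'a \<Rightarrow> 'b::euclidean_space"
  assumes X0: "X 0 = (\<lambda>_. w)"
    and step: "\<And>k. k < K \<Longrightarrow> X (Suc k) = (\<lambda>\<omega>. \<alpha> k *\<^sub>R X k \<omega> - \<beta> k *\<^sub>R \<xi> k \<omega>)"
    and meas: "\<And>k. k < K \<Longrightarrow> \<xi> k \<in> borel_measurable M"
    and sq: "\<And>k. k < K \<Longrightarrow> integrable M (\<lambda>\<omega>. (norm (\<xi> k \<omega>))\<^sup>2)"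
    and mean: "\<And>k. k < K \<Longrightarrow> expectation (\<xi> k) = 0"
    and uncor: "\<And>i j. i < K \<Longrightarrow> j < K \<Longrightarrow> i \<noteq> j \<Longrightarrow> expectation (\<lambda>\<omega>. \<xi> i \<omega> \<bullet> \<xi> j \<omega>) = 0"
  shows "k \<le> K \<Longrightarrow> X k \<in> borel_measurable M \<and> integrable M (\<lambda>\<omega>. (norm (X k \<omega>))\<^sup>2) \<and>
    (\<forall>j\<in>{k..<K}. expectation (\<lambda>\<omega>. X k \<omega> \<bullet> \<xi> j \<omega>) = 0)"
proof (induction k)
  case 0
  \<comment> \<open>A deterministic start is uncorrelated with the noise because the noise is centred.\<close>
  have "expectation (\<lambda>\<omega>. w \<bullet> \<xi> j \<omega>) = 0" if "j < K" for j
    using integral_inner_right[of w M "\<xi> j"] that mean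
      integrable_of_square_integrable_norm[OF meas sq, of j] by simp
  then show ?case
    by (simp add: X0)
next
  case (Suc k)
  then have k: "k < K"
    by simp
  have [measurable]: "X k \<in> borel_measurable M"
    using Suc by simp
  note [measurable] = meas[OF k]
  have Xsq: "integrable M (\<lambda>\<omega>. (norm (X k \<omega>))\<^sup>2)"
    and Xuncor: "\<And>j. k \<le> j \<Longrightarrow> j < K \<Longrightarrow> expectation (\<lambda>\<omega>. X k \<omega> \<bullet> \<xi> j \<omega>) = 0"
    using Suc by simp_all
  have "integrable M (\<lambda>\<omega>. (\<alpha> k)\<^sup>2 * (norm (X k \<omega>))\<^sup>2 - 2 * \<alpha> k * \<beta> k * (X k \<omega> \<bullet> \<xi> k \<omega>)
      + (\<beta> k)\<^sup>2 * (norm (\<xi> k \<omega>))\<^sup>2)"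
    using Xsq sq[OF k] integrable_inner_of_square_integrable[OF _ _ Xsq sq[OF k]] by simp
  then have "integrable M (\<lambda>\<omega>. (norm (X (Suc k) \<omega>))\<^sup>2)"
    unfolding step[OF k] power2_norm_eq_inner
    by (simp add: inner_diff inner_commute power2_eq_square algebra_simps)
  moreover have "expectation (\<lambda>\<omega>. X (Suc k) \<omega> \<bullet> \<xi> j \<omega>) = 0" if j: "Suc k \<le> j" "j < K" for j
  proof -
    have "integrable M (\<lambda>\<omega>. X k \<omega> \<bullet> \<xi> j \<omega>)" "integrable M (\<lambda>\<omega>. \<xi> k \<omega> \<bullet> \<xi> j \<omega>)"
      using integrable_inner_of_square_integrable[OF _ _ Xsq sq[OF j(2)]]
        integrable_inner_of_square_integrable[OF _ _ sq[OF k] sq[OF j(2)]] meas[OF j(2)] by simp_all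
    then show ?thesis
      using Xuncor[of j] uncor[OF k j(2)] j by (simp add: step[OF k] inner_diff_left)
  qed
  ultimately show ?case
    by (simp add: step[OF k])
qed

text \<open>By Pythagoras the newest noise sample contributes its full second moment, whatever the
  factors \<open>\<alpha>\<close> do to the earlier state.\<close>

lemma (in prob_space) linear_recursion_second_moment:
  fixes X \<xi> :: "nat \<Rightarrow> 'a \<Rightarrow> 'b::euclidean_space"
  assumes X0: "X 0 = (\<lambda>_. w)"
    and step: "\<And>k. k < K \<Longrightarrow> X (Suc k) = (\<lambda>\<omega>. \<alpha> k *\<^sub>R X k \<omega> - \<beta> k *\<^sub>R \<xi> k \<omega>)"
    and meas: "\<And>k. k < K \<Longrightarrow> \<xi> k \<in> borel_measurable M"
    and sq: "\<And>k. k < K \<Longrightarrow> integrable M (\<lambda>\<omega>. (norm (\<xi> k \<omega>))\<^sup>2)"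
    and mean: "\<And>k. k < K \<Longrightarrow> expectation (\<xi> k) = 0"
    and uncor: "\<And>i j. i < K \<Longrightarrow> j < K \<Longrightarrow> i \<noteq> j \<Longrightarrow> expectation (\<lambda>\<omega>. \<xi> i \<omega> \<bullet> \<xi> j \<omega>) = 0"
    and k: "k < K"
  shows "integrable M (\<lambda>\<omega>. (norm (X (Suc k) \<omega>))\<^sup>2)"
    and "expectation (\<lambda>\<omega>. (norm (X (Suc k) \<omega>))\<^sup>2) \<ge> (\<beta> k)\<^sup>2 * expectation (\<lambda>\<omega>. (norm (\<xi> k \<omega>))\<^sup>2)"
proof -
  note inv = linear_recursion_uncorrelated[where K = K, OF X0 step meas sq mean uncor]
  show "integrable M (\<lambda>\<omega>. (norm (X (Suc k) \<omega>))\<^sup>2)"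
    using inv[of "Suc k"] k by simp
  have Xmeas: "X k \<in> borel_measurable M" and Xsq: "integrable M (\<lambda>\<omega>. (norm (X k \<omega>))\<^sup>2)"
    and Xuncor: "expectation (\<lambda>\<omega>. X k \<omega> \<bullet> \<xi> k \<omega>) = 0"
    using inv[of k] k by simp_all
  have "expectation (\<lambda>\<omega>. (norm (X (Suc k) \<omega>))\<^sup>2) =
      expectation (\<lambda>\<omega>. (\<alpha> k)\<^sup>2 * (norm (X k \<omega>))\<^sup>2 - 2 * \<alpha> k * \<beta> k * (X k \<omega> \<bullet> \<xi> k \<omega>)
        + (\<beta> k)\<^sup>2 * (norm (\<xi> k \<omega>))\<^sup>2)"
    unfolding step[OF k] power2_norm_eq_inner
    by (simp add: inner_diff inner_commute power2_eq_square algebra_simps)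
  also have "\<dots> = (\<alpha> k)\<^sup>2 * expectation (\<lambda>\<omega>. (norm (X k \<omega>))\<^sup>2)
      + (\<beta> k)\<^sup>2 * expectation (\<lambda>\<omega>. (norm (\<xi> k \<omega>))\<^sup>2)"
    using Xsq sq[OF k] integrable_inner_of_square_integrable[OF Xmeas meas[OF k] Xsq sq[OF k]]
    by (simp add: Xuncor)
  finally show "expectation (\<lambda>\<omega>. (norm (X (Suc k) \<omega>))\<^sup>2)
      \<ge> (\<beta> k)\<^sup>2 * expectation (\<lambda>\<omega>. (norm (\<xi> k \<omega>))\<^sup>2)"
    by simp
qed

section \<open>The quadratic instance\<close>

text \<open>Completing the square exhibits the minimiser and its uniqueness, which is what pins down the
  value chosen by \<open>arg_min\<close>.\<close>

lemma prox_quadratic: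
  fixes g u :: "'a::real_inner" and a m :: real
  assumes "a + m > 0"
  shows "arg_min (\<lambda>x. g \<bullet> x + a / 2 * (norm x)\<^sup>2 + m / 2 * (norm (x - u))\<^sup>2) (\<lambda>_. True)
    = (1 / (a + m)) *\<^sub>R (m *\<^sub>R u - g)"
proof -
  let ?h = "\<lambda>x. g \<bullet> x + a / 2 * (norm x)\<^sup>2 + m / 2 * (norm (x - u))\<^sup>2"
  define y where "y = (1 / (a + m)) *\<^sub>R (m *\<^sub>R u - g)"
  have g: "g = m *\<^sub>R u - (a + m) *\<^sub>R y"
    using assms by (simp add: y_def)
  have square: "?h x = ?h y + (a + m) / 2 * (norm (x - y))\<^sup>2" for x
    unfolding g power2_norm_eq_inner
    by (simp add: inner_diff inner_add inner_commute algebra_simps add_divide_distrib diff_divide_distrib)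
  have "?h (arg_min ?h (\<lambda>_. True)) = ?h y"
  proof (rule arg_min_equality)
    show "?h y \<le> ?h x" for x
      using square[of x] assms by simp
  qed simp
  then have "(a + m) / 2 * (norm (arg_min ?h (\<lambda>_. True) - y))\<^sup>2 = 0"
    using square[of "arg_min ?h (\<lambda>_. True)"] by linarith
  then show ?thesis
    using assms by (simp add: y_def)
qed

lemma GDERIV_half_norm_squared:
  fixes x :: "'a::real_inner"
  shows "GDERIV (\<lambda>x. c / 2 * (norm x)\<^sup>2) x :> c *\<^sub>R x"
  unfolding gderiv_def power2_norm_eq_inner
  by (auto intro!: derivative_eq_intros simp: inner_commute)

text \<open>The coefficient of the noise sample in the recursion is \<open>1 / (a + M\<^sub>k) \<ge> 1 / (2 a)\<close>, which the
  gradient \<open>(L + a) x\<close> of the composite objective turns into a factor of at least \<open>1/2\<close>.\<close>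

lemma (in prob_space) sprox_grad_quadratic_second_moment:
  fixes \<xi> :: "nat \<Rightarrow> 'a \<Rightarrow> 'b::euclidean_space" and m :: "nat \<Rightarrow> real" and w :: 'b
  assumes L: "L > 0" and m: "\<And>k. k < K \<Longrightarrow> 0 < m k \<and> m k \<le> a"
    and meas: "\<And>k. k < K \<Longrightarrow> \<xi> k \<in> borel_measurable M"
    and sq: "\<And>k. k < K \<Longrightarrow> integrable M (\<lambda>\<omega>. (norm (\<xi> k \<omega>))\<^sup>2)"
    and mean: "\<And>k. k < K \<Longrightarrow> expectation (\<xi> k) = 0"
    and uncor: "\<And>i j. i < K \<Longrightarrow> j < K \<Longrightarrow> i \<noteq> j \<Longrightarrow> expectation (\<lambda>\<omega>. \<xi> i \<omega> \<bullet> \<xi> j \<omega>) = 0"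
    and k: "k < K"
  defines "X \<equiv> \<lambda>k \<omega>. sprox_grad (\<lambda>x z. L *\<^sub>R x + z) (\<lambda>x. a / 2 * (norm x)\<^sup>2) m w (\<lambda>j. \<xi> j \<omega>) k"
  shows "integrable M (\<lambda>\<omega>. (norm ((L + a) *\<^sub>R X (Suc k) \<omega>))\<^sup>2)"
    and "expectation (\<lambda>\<omega>. (norm ((L + a) *\<^sub>R X (Suc k) \<omega>))\<^sup>2)
      \<ge> 1 / 4 * expectation (\<lambda>\<omega>. (norm (\<xi> k \<omega>))\<^sup>2)"
proof -
  have X0: "X 0 = (\<lambda>_. w)"
    by (simp add: X_def)
  have step: "X (Suc k) = (\<lambda>\<omega>. ((m k - L) / (a + m k)) *\<^sub>R X k \<omega> - (1 / (a + m k)) *\<^sub>R \<xi> k \<omega>)"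
    if "k < K" for k
  proof
    fix \<omega>
    have "X (Suc k) \<omega> = (1 / (a + m k)) *\<^sub>R (m k *\<^sub>R X k \<omega> - (L *\<^sub>R X k \<omega> + \<xi> k \<omega>))"
      unfolding X_def sprox_grad.simps Let_def
      using m[OF that] by (intro prox_quadratic) auto
    also have "\<dots> = (1 / (a + m k)) *\<^sub>R ((m k - L) *\<^sub>R X k \<omega> - \<xi> k \<omega>)"
      by (simp add: algebra_simps)
    finally show "X (Suc k) \<omega> = ((m k - L) / (a + m k)) *\<^sub>R X k \<omega> - (1 / (a + m k)) *\<^sub>R \<xi> k \<omega>"
      by (simp add: scaleR_diff_right)
  qed
  note rec = linear_recursion_second_moment[OF X0 step meas sq mean uncor k]
  show "integrable M (\<lambda>\<omega>. (norm ((L + a) *\<^sub>R X (Suc k) \<omega>))\<^sup>2)"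
    using rec(1) by (simp add: power_mult_distrib)
  have "1 / 2 \<le> (L + a) / (a + m k)"
    using m[OF k] L by (simp add: field_simps)
  then have "(1 / 2)\<^sup>2 \<le> ((L + a) / (a + m k))\<^sup>2"
    by (rule power_mono) simp
  then have factor: "1 / 4 \<le> (L + a)\<^sup>2 * (1 / (a + m k))\<^sup>2"
    by (simp add: power_divide)
  have "1 / 4 * expectation (\<lambda>\<omega>. (norm (\<xi> k \<omega>))\<^sup>2)
      \<le> (L + a)\<^sup>2 * (1 / (a + m k))\<^sup>2 * expectation (\<lambda>\<omega>. (norm (\<xi> k \<omega>))\<^sup>2)"
    by (intro mult_right_mono factor integral_nonneg_AE) simp
  also have "\<dots> \<le> (L + a)\<^sup>2 * expectation (\<lambda>\<omega>. (norm (X (Suc k) \<omega>))\<^sup>2)"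
    using mult_left_mono[OF rec(2), of "(L + a)\<^sup>2"] by (simp add: mult.assoc)
  also have "\<dots> = expectation (\<lambda>\<omega>. (norm ((L + a) *\<^sub>R X (Suc k) \<omega>))\<^sup>2)"
    by (simp add: power_mult_distrib)
  finally show "expectation (\<lambda>\<omega>. (norm ((L + a) *\<^sub>R X (Suc k) \<omega>))\<^sup>2)
      \<ge> 1 / 4 * expectation (\<lambda>\<omega>. (norm (\<xi> k \<omega>))\<^sup>2)" .
qed

lemma isotropic_gaussian_oracle_mean:
  fixes c :: "real ^ 'd::finite"
  assumes "v \<ge> 0"
  shows "integrable (isotropic_gaussian v) (\<lambda>z. c + z)"
    and "integral\<^sup>L (isotropic_gaussian v) (\<lambda>z. c + z) = c"
proof -
  interpret prob_space "isotropic_gaussian v :: (real ^ 'd) measure"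
    by (rule prob_space_isotropic_gaussian)
  have int: "integrable (isotropic_gaussian v) (\<lambda>z :: real ^ 'd. z)"
    by (rule integrable_of_square_integrable_norm)
      (use isotropic_gaussian_second_moment[OF assms, where 'd = 'd] in
        \<open>auto simp: has_bochner_integral_iff\<close>)
  have "(LINT z|isotropic_gaussian v. z :: real ^ 'd) $ i = 0" for i
    using integral_inner_left[OF int, of "axis i 1"] isotropic_gaussian_nth_mean[of v i]
    by (simp add: inner_axis has_bochner_integral_iff)
  then have "(LINT z|isotropic_gaussian v. z :: real ^ 'd) = 0"
    by (simp add: vec_eq_iff)
  then show "integral\<^sup>L (isotropic_gaussian v) (\<lambda>z. c + z) = c"
    using int by simp (simp add: prob_space)
  show "integrable (isotropic_gaussian v) (\<lambda>z. c + z)"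
    using int by simp
qed

text \<open>The noise is only given through its law, so its moments are read off from the law by a change
  of variables.\<close>

lemma (in prob_space) sprox_grad_gaussian_second_moment:
  fixes \<xi> :: "nat \<Rightarrow> 'a \<Rightarrow> real ^ 'd::finite" and m :: "nat \<Rightarrow> real" and w
  assumes L: "L > 0" and m: "\<And>k. k < K \<Longrightarrow> 0 < m k \<and> m k \<le> a" and v: "v \<ge> 0"
    and indep: "indep_vars (\<lambda>_. borel) \<xi> {..<K}"
    and law: "\<And>k. k < K \<Longrightarrow> distr M borel (\<xi> k) = isotropic_gaussian v"
    and k: "k < K"
  defines "X \<equiv> \<lambda>k \<omega>. sprox_grad (\<lambda>x z. L *\<^sub>R x + z) (\<lambda>x. a / 2 * (norm x)\<^sup>2) m w (\<lambda>j. \<xi> j \<omega>) k"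
  shows "integrable M (\<lambda>\<omega>. (norm ((L + a) *\<^sub>R X (Suc k) \<omega>))\<^sup>2)"
    and "expectation (\<lambda>\<omega>. (norm ((L + a) *\<^sub>R X (Suc k) \<omega>))\<^sup>2) \<ge> 1 / 4 * (real CARD('d) * v)"
proof -
  have meas: "\<xi> k \<in> borel_measurable M" if "k < K" for k
    using indep that by (auto simp: indep_vars_def)
  have sq': "has_bochner_integral M (\<lambda>\<omega>. (norm (\<xi> k \<omega>))\<^sup>2) (real CARD('d) * v)" if "k < K" for k
    using isotropic_gaussian_second_moment[OF v, where 'd = 'd] meas[OF that]
    unfolding law[OF that, symmetric] by (subst (asm) has_bochner_integral_distr_iff) auto
  then have sq: "integrable M (\<lambda>\<omega>. (norm (\<xi> k \<omega>))\<^sup>2)" if "k < K" for k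
    using that by (simp add: has_bochner_integral_iff)
  have mean: "expectation (\<xi> k) = 0" if "k < K" for k
    using isotropic_gaussian_oracle_mean(2)[OF v, where c = "0 :: real ^ 'd"] meas[OF that]
    unfolding law[OF that, symmetric] by (subst (asm) integral_distr) auto
  have int: "integrable M (\<xi> k)" if "k < K" for k
    by (rule integrable_of_square_integrable_norm[OF meas[OF that] sq[OF that]])
  have uncor: "expectation (\<lambda>\<omega>. \<xi> i \<omega> \<bullet> \<xi> j \<omega>) = 0" if "i < K" "j < K" "i \<noteq> j" for i j
    using that by (intro indep_vars_centred_uncorrelated[OF indep] int mean) auto
  note bound = sprox_grad_quadratic_second_moment[where w = w, OF L m meas sq mean uncor k]
  show "integrable M (\<lambda>\<omega>. (norm ((L + a) *\<^sub>R X (Suc k) \<omega>))\<^sup>2)"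
    unfolding X_def by (rule bound(1))
  have "expectation (\<lambda>\<omega>. (norm (\<xi> k \<omega>))\<^sup>2) = real CARD('d) * v"
    using sq'[OF k] by (simp add: has_bochner_integral_iff)
  moreover have "1 / 4 * expectation (\<lambda>\<omega>. (norm (\<xi> k \<omega>))\<^sup>2)
      \<le> expectation (\<lambda>\<omega>. (norm ((L + a) *\<^sub>R X (Suc k) \<omega>))\<^sup>2)"
    unfolding X_def by (rule bound(2))
  ultimately show "expectation (\<lambda>\<omega>. (norm ((L + a) *\<^sub>R X (Suc k) \<omega>))\<^sup>2) \<ge> 1 / 4 * (real CARD('d) * v)"
    by simp
qed

theorem proposition1:
  fixes L \<sigma> :: real and K :: nat and M :: "nat \<Rightarrow> real"
  assumes "L > 0" and "\<sigma> \<ge> 0" and "K \<ge> 1" and "\<And>k. k < K \<Longrightarrow> M k > 0"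
  shows "\<exists>(a :: real) (f :: real ^ 'd::finite \<Rightarrow> real) (\<psi> :: real ^ 'd \<Rightarrow> real)
      (gradf :: real ^ 'd \<Rightarrow> real ^ 'd) (gradF :: real ^ 'd \<Rightarrow> real ^ 'd)
      (G :: real ^ 'd \<Rightarrow> real ^ 'd \<Rightarrow> real ^ 'd).
    a = Max (M ` {0..K - 1}) \<and>
    f = (\<lambda>x. L / 2 * (norm x)\<^sup>2) \<and>
    \<psi> = (\<lambda>x. a / 2 * (norm x)\<^sup>2) \<and>
    (\<forall>x. GDERIV f x :> gradf x) \<and>
    (\<forall>x. GDERIV (\<lambda>y. f y + \<psi> y) x :> gradF x) \<and>
    G = (\<lambda>x z. gradf x + z) \<and>
    (\<exists>Fstar. \<forall>x. Fstar \<le> f x + \<psi> x) \<and>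
    (\<forall>x y. norm (gradf x - gradf y) \<le> L * norm (x - y)) \<and>
    (\<forall>v \<in> {\<sigma>\<^sup>2, \<sigma>\<^sup>2 / real CARD('d)}.
      (\<forall>x. integrable (isotropic_gaussian v) (G x) \<and>
           integral\<^sup>L (isotropic_gaussian v) (G x) = gradf x) \<and>
      (v = \<sigma>\<^sup>2 / real CARD('d) \<longrightarrow>
        (\<forall>x. integrable (isotropic_gaussian v) (\<lambda>z. (norm (G x z - gradf x))\<^sup>2) \<and>
             (LINT z|isotropic_gaussian v. (norm (G x z - gradf x))\<^sup>2) \<le> \<sigma>\<^sup>2)) \<and>
      (\<forall>(P :: 'w measure) (\<xi> :: nat \<Rightarrow> 'w \<Rightarrow> real ^ 'd) (x\<^sub>0 :: real ^ 'd).
        prob_space P \<and>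
        prob_space.indep_vars P (\<lambda>_. borel) \<xi> {0..K - 1} \<and>
        (\<forall>k\<in>{0..K - 1}. distr P borel (\<xi> k) = isotropic_gaussian v) \<longrightarrow>
        (\<forall>k\<in>{1..K}.
          integrable P (\<lambda>\<omega>. (norm (gradF (sprox_grad G \<psi> M x\<^sub>0 (\<lambda>j. \<xi> j \<omega>) k)))\<^sup>2) \<and>
          (LINT \<omega>|P. (norm (gradF (sprox_grad G \<psi> M x\<^sub>0 (\<lambda>j. \<xi> j \<omega>) k)))\<^sup>2)
            \<ge> 1 / 4 * \<sigma>\<^sup>2)))"
proof -
  define a where "a = Max (M ` {0..K - 1})"
  have M: "0 < M k \<and> M k \<le> a" if "k < K" for k
    using that assms(4) by (auto simp: a_def intro!: Max_ge)
  then have "0 < a"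
    using M[of 0] assms(3) by (meson less_le_trans less_one)
  have index: "{0..K - 1} = {..<K}"
    using assms(3) by auto
  let ?f = "\<lambda>x :: real ^ 'd. L / 2 * (norm x)\<^sup>2"
  let ?\<psi> = "\<lambda>x :: real ^ 'd. a / 2 * (norm x)\<^sup>2"
  let ?G = "\<lambda>x z :: real ^ 'd. L *\<^sub>R x + z"
  have grad_F: "GDERIV (\<lambda>y. ?f y + ?\<psi> y) x :> (L + a) *\<^sub>R x" for x
    using GDERIV_half_norm_squared[of "L + a" x] by (simp add: add_divide_distrib distrib_right)
  \<comment> \<open>Both scalings reach the variance \<open>\<sigma>\<^sup>2\<close> of the bound: \<open>v = \<sigma>\<^sup>2 / d\<close> exactly, and \<open>v = \<sigma>\<^sup>2\<close>
    because \<open>d \<ge> 1\<close>.\<close>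
  have v: "0 \<le> v \<and> \<sigma>\<^sup>2 \<le> real CARD('d) * v" if "v \<in> {\<sigma>\<^sup>2, \<sigma>\<^sup>2 / real CARD('d)}" for v
    using that mult_right_mono[of 1 "real CARD('d)" "\<sigma>\<^sup>2"] by auto
  have oracle_variance:
    "integrable (isotropic_gaussian v) (\<lambda>z. (norm (?G x z - L *\<^sub>R x))\<^sup>2) \<and>
     (LINT z|isotropic_gaussian v. (norm (?G x z - L *\<^sub>R x))\<^sup>2) \<le> \<sigma>\<^sup>2"
    if "v = \<sigma>\<^sup>2 / real CARD('d)" for v x
    using isotropic_gaussian_second_moment[of v, where 'd = 'd] that
    by (simp add: has_bochner_integral_iff)
  have lower_bound:
    "integrable P (\<lambda>\<omega>. (norm ((L + a) *\<^sub>R sprox_grad ?G ?\<psi> M x\<^sub>0 (\<lambda>j. \<xi> j \<omega>) k))\<^sup>2) \<and>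
     (LINT \<omega>|P. (norm ((L + a) *\<^sub>R sprox_grad ?G ?\<psi> M x\<^sub>0 (\<lambda>j. \<xi> j \<omega>) k))\<^sup>2) \<ge> 1 / 4 * \<sigma>\<^sup>2"
    if "v \<in> {\<sigma>\<^sup>2, \<sigma>\<^sup>2 / real CARD('d)}" and "prob_space P"
      and "prob_space.indep_vars P (\<lambda>_. borel) \<xi> {0..K - 1}"
      and "\<forall>k\<in>{0..K - 1}. distr P borel (\<xi> k) = isotropic_gaussian v"
      and k: "k \<in> {1..K}"
    for v and P :: "'w measure" and \<xi> :: "nat \<Rightarrow> 'w \<Rightarrow> real ^ 'd" and x\<^sub>0 k
  proof -
    interpret prob_space P
      by fact
    obtain j where j: "k = Suc j" "j < K"
      using k by (cases k) auto
    have law: "\<And>k. k < K \<Longrightarrow> distr P borel (\<xi> k) = isotropic_gaussian v"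
      using that(4) by (auto simp: index)
    note bound = sprox_grad_gaussian_second_moment[where m = M and w = x\<^sub>0, OF assms(1) M conjunct1[OF v[OF that(1)]]
        that(3)[unfolded index] law j(2)]
    show ?thesis
      unfolding j(1) using v[OF that(1)]
      by (intro conjI bound(1) order_trans[OF _ bound(2)]) simp_all
  qed
  show ?thesis
  proof (rule exI[of _ a], rule exI[of _ ?f], rule exI[of _ ?\<psi>],
      rule exI[of _ "\<lambda>x. L *\<^sub>R x"], rule exI[of _ "\<lambda>x. (L + a) *\<^sub>R x"], rule exI[of _ ?G],
      intro conjI ballI)
    show "\<exists>Fstar. \<forall>x. Fstar \<le> ?f x + ?\<psi> x"
      using assms(1) \<open>0 < a\<close> by (intro exI[of _ 0]) simp
    show "\<forall>x y :: real ^ 'd. norm (L *\<^sub>R x - L *\<^sub>R y) \<le> L * norm (x - y)"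
      using assms(1) by (simp flip: scaleR_diff_right)
  next
    fix v assume vin: "v \<in> {\<sigma>\<^sup>2, \<sigma>\<^sup>2 / real CARD('d)}"
    show "\<forall>x. integrable (isotropic_gaussian v) (?G x) \<and>
        integral\<^sup>L (isotropic_gaussian v) (?G x) = L *\<^sub>R x"
      using isotropic_gaussian_oracle_mean v[OF vin] by blast
    show "v = \<sigma>\<^sup>2 / real CARD('d) \<longrightarrow>
        (\<forall>x. integrable (isotropic_gaussian v) (\<lambda>z. (norm (?G x z - L *\<^sub>R x))\<^sup>2) \<and>
             (LINT z|isotropic_gaussian v. (norm (?G x z - L *\<^sub>R x))\<^sup>2) \<le> \<sigma>\<^sup>2)"
      using oracle_variance by blast
  qed ((rule a_def refl allI GDERIV_half_norm_squared grad_F)+,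
      (intro impI ballI, elim conjE, rule lower_bound; assumption))
qed

end
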